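(* Let $H$ be a bipartite graph. (1) There exists a family $\mathcal{B}$ of subgraphs that $\dim(H)$-covers $H^c$. (2) If $H^c$ can be $r$-covered, then $\dim(H)\le r^2+2$.
   Context: Graphs are finite, simple and loopless. For a bipartite graph $F$ with bipartition classes $X,Y$, its bipartite complement $F^c$ is the bipartite graph with classes $X,Y$ in which $uv\in X\times Y$ is an edge iff $uv\notin E(F)$. A family $\mathcal{B}=\{B_1,\dots,B_s\}$ of subgraphs of a bipartite graph $F$ $r$-covers $F$ if each $B_i$ is a biclique (complete bipartite graph), $\bigcup_i E(B_i)=E(F)$, and every vertex of $F$ lies in at most $r$ members of $\mathcal{B}$; $F$ can be $r$-covered if such a family exists. The Prague dimension $\dim(H)$ is the least integer $p$ such that there exist integers $n_1,\dots,n_p$ for which $H$ is isomorphic to an induced subgraph of the direct product $K_{n_1}\times\cdots\times K_{n_p}$ of complete graphs; equivalently, the vertices of $H$ can be encoded by distinct sequences of length $p$ such that two vertices are adjacent iff their sequences differ in every coordinate. (The direct product $H_1\times H_2$ has vertex set $V(H_1)\times V(H_2)$ with $(v_1,v_2)(u_1,u_2)$ an edge iff $v_1u_1\in E(H_1)$ and $v_2u_2\in E(H_2)$.) *)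

theory Defs
  imports "Graph_Theory.Graph_Theory"
begin

text \<open>
  A finite simple loopless graph is a \<^locale>\<open>pair_graph\<close>: an undirected edge \<open>uv\<close> is the pair of
  opposite arcs \<open>(u, v)\<close>, \<open>(v, u)\<close>.
\<close>

definition bipartition :: "'a pair_pre_digraph \<Rightarrow> 'a set \<Rightarrow> 'a set \<Rightarrow> bool" where
  "bipartition F X Y \<longleftrightarrow>
     X \<inter> Y = {} \<and> pverts F = X \<union> Y \<and> parcs F \<subseteq> X \<times> Y \<union> Y \<times> X"

definition bipartite_complement ::
  "'a set \<Rightarrow> 'a set \<Rightarrow> 'a pair_pre_digraph \<Rightarrow> 'a pair_pre_digraph" where
  "bipartite_complement X Y F =
     \<lparr> pverts = X \<union> Y, parcs = (X \<times> Y \<union> Y \<times> X) - parcs F \<rparr>"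

definition biclique :: "'a pair_pre_digraph \<Rightarrow> bool" where
  "biclique B \<longleftrightarrow> (\<exists>m n. K\<^bsub>m,n\<^esub> (with_proj B))"

definition r_covers :: "nat \<Rightarrow> 'a pair_pre_digraph set \<Rightarrow> 'a pair_pre_digraph \<Rightarrow> bool" where
  "r_covers r \<B> F \<longleftrightarrow>
     finite \<B> \<and>
     (\<forall>B\<in>\<B>. subgraph (with_proj B) (with_proj F) \<and> biclique B) \<and>
     (\<Union>B\<in>\<B>. parcs B) = parcs F \<and>
     (\<forall>v\<in>pverts F. card {B \<in> \<B>. v \<in> pverts B} \<le> r)"

definition r_coverable :: "nat \<Rightarrow> 'a pair_pre_digraph \<Rightarrow> bool" where
  "r_coverable r F \<longleftrightarrow> (\<exists>\<B>. r_covers r \<B> F)"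

text \<open>
  The direct product of a list of graphs; its vertices are the lists picking one vertex from each
  factor. The product of the empty list is a single vertex with a loop, so that the only loopless
  graph contained in it as an induced subgraph is the one without vertices.
\<close>

definition direct_product :: "'a pair_pre_digraph list \<Rightarrow> 'a list pair_pre_digraph" where
  "direct_product Gs =
     \<lparr> pverts = {us. list_all2 (\<lambda>u G. u \<in> pverts G) us Gs},
       parcs = {(us, vs). length us = length Gs \<and> length vs = length Gs \<and>
                  (\<forall>i<length Gs. (us ! i, vs ! i) \<in> parcs (Gs ! i))} \<rparr>"

definition embeds_in_complete_product :: "'a pair_pre_digraph \<Rightarrow> nat \<Rightarrow> bool" where
  "embeds_in_complete_product H p \<longleftrightarrow>
     (\<exists>(ns :: nat list) (Ks :: nat pair_pre_digraph list) G.
        length ns = p \<and>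
        list_all2 (\<lambda>n K. K\<^bsub>n\<^esub> (with_proj K)) ns Ks \<and>
        induced_subgraph G (with_proj (direct_product Ks)) \<and>
        digraph_iso (with_proj H) G)"

definition prague_dim :: "'a pair_pre_digraph \<Rightarrow> nat" where
  "prague_dim H = (LEAST p. embeds_in_complete_product H p)"

end

theory Submission
  imports Defs
begin

text \<open>
  An embedding into a product of \<open>p\<close> complete graphs is a \<open>p\<close>-coordinate encoding of the vertices.
  For (1), the bicliques are the level sets of the coordinates. For (2), number the at most \<open>r\<close>
  bicliques containing each vertex; the coordinate \<open>(a, b) \<in> {..<r} \<times> {..<r}\<close> holds the \<open>a\<close>-th biclique of
  \<open>x \<in> X\<close> and the \<open>b\<close>-th biclique of \<open>y \<in> Y\<close>, so that \<open>x\<close> and \<open>y\<close> agree somewhere iff they share a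
  biclique. Two further coordinates, one constant exactly on \<open>X\<close> and one constant exactly on \<open>Y\<close>,
  make each class independent and the code injective.
\<close>

section \<open>Embeddings into products of complete graphs as coordinate codes\<close>

text \<open>Only the first \<open>p\<close> values of \<open>f v\<close> form the code of
  \<open>v\<close>. The first conjunct keeps codes distinct, which the second does not force for
  non-adjacent vertices. For \<open>p = 0\<close> the second would put a loop on every vertex, so a
  loopless graph must then be empty.\<close>

definition encodes :: "nat \<Rightarrow> 'a pair_pre_digraph \<Rightarrow> ('a \<Rightarrow> nat \<Rightarrow> nat) \<Rightarrow> bool" where
  "encodes p H f \<longleftrightarrow>
     (\<forall>u\<in>pverts H. \<forall>v\<in>pverts H. (\<forall>i<p. f u i = f v i) \<longrightarrow> u = v) \<and>
     (\<forall>u\<in>pverts H. \<forall>v\<in>pverts H. (u, v) \<in> parcs H \<longleftrightarrow> (\<forall>i<p. f u i \<noteq> f v i))"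

lemma subgraph_with_proj_iff:
  "subgraph (with_proj A) (with_proj B) \<longleftrightarrow>
     pverts A \<subseteq> pverts B \<and> parcs A \<subseteq> parcs B \<and>
     parcs A \<subseteq> pverts A \<times> pverts A \<and> parcs B \<subseteq> pverts B \<times> pverts B"
  by (auto simp: subgraph_def wf_digraph_def compatible_def subset_iff mem_Times_iff)

lemma wf_direct_product:
  assumes "\<And>G. G \<in> set Gs \<Longrightarrow> parcs G \<subseteq> pverts G \<times> pverts G"
  shows "wf_digraph (with_proj (direct_product Gs))"
proof -
  have "us ! i \<in> pverts (Gs ! i) \<and> vs ! i \<in> pverts (Gs ! i)"
    if "(us, vs) \<in> parcs (direct_product Gs)" "i < length Gs" for us vs i
    using that assms[of "Gs ! i"] by (auto simp: direct_product_def)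
  then show ?thesis
    by unfold_locales (auto simp: direct_product_def list_all2_conv_all_nth)
qed

text \<open>Quantifying over both sizes leaves only finiteness. A side may be empty, so finite
  edgeless graphs count as bicliques.\<close>

lemma biclique_iff:
  "biclique B \<longleftrightarrow> finite (pverts B) \<and>
     (\<exists>U W. pverts B = U \<union> W \<and> U \<inter> W = {} \<and> parcs B = U \<times> W \<union> W \<times> U)"
  unfolding biclique_def complete_bipartite_digraph_pair_def by blast

text \<open>Adjacency in a complete graph means being different, so adjacency in the product means
  differing in every coordinate. The image of a vertex is therefore already its code.\<close>

lemma encodes_if_embeds:
  assumes "embeds_in_complete_product H p"
  shows "\<exists>f. encodes p H f"
proof -
  obtain ns and Ks :: "nat pair_pre_digraph list" and G where len: "length ns = p"
    and Ks: "list_all2 (\<lambda>n K. K\<^bsub>n\<^esub> (with_proj K)) ns Ks"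
    and ind: "induced_subgraph G (with_proj (direct_product Ks))"
    and iso: "digraph_iso (with_proj H) G"
    using assms unfolding embeds_in_complete_product_def by blast
  obtain h where h: "pre_digraph.digraph_isomorphism (with_proj H) h" and G: "G = app_iso h (with_proj H)"
    using iso unfolding digraph_iso_def by blast
  define \<phi> where "\<phi> = iso_verts h"
  have lenK: "length Ks = p"
    using Ks len list_all2_lengthD by metis
  have K: "parcs (Ks ! i) = {(u, v). (u, v) \<in> pverts (Ks ! i) \<times> pverts (Ks ! i) \<and> u \<noteq> v}"
    if "i < p" for i
    using Ks that len lenK by (simp add: list_all2_conv_all_nth complete_digraph_pair_def)
  have inj: "inj_on \<phi> (pverts H)"
    using h by (simp add: pre_digraph.digraph_isomorphism_def \<phi>_def)
  have vG: "verts G = \<phi> ` pverts H"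
    by (simp add: G \<phi>_def)
  have comp: "tail G = fst" "head G = snd"
    and sub: "verts G \<subseteq> pverts (direct_product Ks)"
    and arcG: "arcs G = {e \<in> parcs (direct_product Ks). fst e \<in> verts G \<and> snd e \<in> verts G}"
    using ind unfolding induced_subgraph_def subgraph_def compatible_def by auto
  \<comment> \<open>Tail and head in \<open>G\<close> are the projections, so the vertex map
    determines the arc map.\<close>
  have arc: "iso_arcs h e = (\<phi> (fst e), \<phi> (snd e))" if "e \<in> parcs H" for e
    using h that comp unfolding pre_digraph.digraph_isomorphism_def
    by (simp add: \<phi>_def G prod_eq_iff)
  have wf: "parcs H \<subseteq> pverts H \<times> pverts H"
    using h by (fastforce simp: pre_digraph.digraph_isomorphism_def wf_digraph_def)
  have arcs_iff: "(u, v) \<in> parcs H \<longleftrightarrow> (\<phi> u, \<phi> v) \<in> parcs (direct_product Ks)"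
    if u: "u \<in> pverts H" and v: "v \<in> pverts H" for u v
  proof -
    have "(u, v) \<in> parcs H \<longleftrightarrow> (\<phi> u, \<phi> v) \<in> arcs G"
    proof
      assume "(u, v) \<in> parcs H"
      then show "(\<phi> u, \<phi> v) \<in> arcs G" using arc[of "(u, v)"] by (force simp: G)
    next
      assume "(\<phi> u, \<phi> v) \<in> arcs G"
      then obtain e where e: "e \<in> parcs H" "(\<phi> u, \<phi> v) = iso_arcs h e" by (auto simp: G)
      have "fst e \<in> pverts H" "snd e \<in> pverts H" using wf e(1) by auto
      moreover have "\<phi> (fst e) = \<phi> u" "\<phi> (snd e) = \<phi> v" using arc[OF e(1)] e(2) by auto
      ultimately have "fst e = u" "snd e = v" using inj u v by (simp_all add: inj_on_eq_iff)
      then show "(u, v) \<in> parcs H" using e(1) by auto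
    qed
    then show ?thesis using arcG vG u v by auto
  qed
  have mem: "length (\<phi> u) = p \<and> (\<forall>i<p. \<phi> u ! i \<in> pverts (Ks ! i))" if "u \<in> pverts H" for u
    using sub vG that lenK by (fastforce simp: direct_product_def list_all2_conv_all_nth)
  have "encodes p H (\<lambda>u i. \<phi> u ! i)"
    unfolding encodes_def
  proof (intro conjI ballI impI)
    fix u v assume uv: "u \<in> pverts H" "v \<in> pverts H"
    show "u = v" if "\<forall>i<p. \<phi> u ! i = \<phi> v ! i"
      using that mem uv inj by (metis inj_onD nth_equalityI)
    show "(u, v) \<in> parcs H \<longleftrightarrow> (\<forall>i<p. \<phi> u ! i \<noteq> \<phi> v ! i)"
      using arcs_iff[OF uv] mem[OF uv(1)] mem[OF uv(2)] K
      by (auto simp: direct_product_def lenK)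
  qed
  then show ?thesis by blast
qed

text \<open>All \<open>p\<close> factors can be the same complete graph on \<open>{..<n}\<close>,
  with \<open>n\<close> above every value that the code takes on the finite vertex set.\<close>

lemma embeds_if_encodes:
  assumes fin: "finite (pverts H)" and wf: "parcs H \<subseteq> pverts H \<times> pverts H"
    and enc: "encodes p H f"
  shows "embeds_in_complete_product H p"
proof -
  have "finite (\<Union>i<p. (\<lambda>v. f v i) ` pverts H)" using fin by blast
  then obtain n where "(\<Union>i<p. (\<lambda>v. f v i) ` pverts H) \<subseteq> {..<n}"
    using finite_nat_iff_bounded by blast
  then have n: "f v i < n" if "v \<in> pverts H" "i < p" for v i
    using that by blast
  define K where "K = \<lparr>pverts = {..<n}, parcs = {(u, v). (u, v) \<in> {..<n} \<times> {..<n} \<and> u \<noteq> v}\<rparr>"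
  define P where "P = direct_product (replicate p K)"
  define \<phi> where "\<phi> v = map (f v) [0..<p]" for v
  define h where "h = \<lparr>iso_verts = \<phi>, iso_arcs = map_prod \<phi> \<phi>, iso_head = snd, iso_tail = fst\<rparr>"
  define G where "G = app_iso h (with_proj H)"
  have K: "K\<^bsub>n\<^esub> (with_proj K)"
    by (simp add: complete_digraph_pair_def K_def)
  have inj: "inj_on \<phi> (pverts H)"
  proof (rule inj_onI)
    fix u v assume *: "u \<in> pverts H" "v \<in> pverts H" "\<phi> u = \<phi> v"
    then have "\<forall>i<p. f u i = f v i" by (auto simp: \<phi>_def)
    then show "u = v" using enc * unfolding encodes_def by blast
  qed
  have injE: "inj_on (map_prod \<phi> \<phi>) (parcs H)"
    using map_prod_inj_on[OF inj inj] wf by (rule inj_on_subset)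
  have wfH: "wf_digraph (with_proj H)"
    using wf by unfold_locales auto
  have iso: "pre_digraph.digraph_isomorphism (with_proj H) h"
    unfolding pre_digraph.digraph_isomorphism_def using inj injE wfH by (simp add: h_def)
  have vG: "verts G = \<phi> ` pverts H" and aG: "arcs G = map_prod \<phi> \<phi> ` parcs H"
    and "tail G = fst" "head G = snd"
    by (simp_all add: G_def h_def)
  have vP: "\<phi> ` pverts H \<subseteq> pverts P"
    using n by (auto simp: P_def direct_product_def list_all2_conv_all_nth \<phi>_def K_def)
  have arcs_iff: "(u, v) \<in> parcs H \<longleftrightarrow> (\<phi> u, \<phi> v) \<in> parcs P"
    if "u \<in> pverts H" "v \<in> pverts H" for u v
    using enc that n unfolding encodes_def
    by (auto simp: P_def direct_product_def \<phi>_def K_def)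
  \<comment> \<open>This equality, not just an inclusion, makes the image an induced
    subgraph.\<close>
  have aG': "arcs G = {e \<in> parcs P. fst e \<in> verts G \<and> snd e \<in> verts G}"
  proof (intro equalityI subsetI)
    fix e assume "e \<in> arcs G"
    then obtain u v where "e = (\<phi> u, \<phi> v)" "(u, v) \<in> parcs H" by (auto simp: aG)
    moreover from this have "u \<in> pverts H" "v \<in> pverts H" using wf by auto
    ultimately show "e \<in> {e \<in> parcs P. fst e \<in> verts G \<and> snd e \<in> verts G}"
      using arcs_iff by (simp add: vG)
  next
    fix e assume "e \<in> {e \<in> parcs P. fst e \<in> verts G \<and> snd e \<in> verts G}"
    then obtain u v where uv: "u \<in> pverts H" "v \<in> pverts H" "e = (\<phi> u, \<phi> v)" "e \<in> parcs P"
      by (cases e) (auto simp: vG)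
    then have "(u, v) \<in> parcs H" using arcs_iff by simp
    then show "e \<in> arcs G" using uv(3) by (force simp: aG)
  qed
  have "wf_digraph (with_proj P)"
    unfolding P_def by (rule wf_direct_product) (auto simp: K_def)
  moreover have "wf_digraph G"
    unfolding G_def using iso wf_digraph.wf_digraphI_app_iso[OF wfH] by blast
  ultimately have "induced_subgraph G (with_proj P)"
    unfolding induced_subgraph_def subgraph_def compatible_def
    using vP aG' vG \<open>tail G = fst\<close> \<open>head G = snd\<close> by auto
  moreover have "digraph_iso (with_proj H) G"
    unfolding digraph_iso_def using iso G_def by blast
  ultimately show ?thesis
    unfolding embeds_in_complete_product_def P_def using K
    by (intro exI[of _ "replicate p n"] exI[of _ "replicate p K"] exI[of _ G])
      (simp add: list_all2_conv_all_nth)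
qed

section \<open>From a code to a cover of the bipartite complement\<close>

text \<open>Vertices agreeing in a coordinate are non-adjacent, so each level set spans a biclique
  of the complement. Conversely, a non-edge across the classes has an agreeing coordinate and lies
  in that level set.\<close>

lemma covers_if_encodes:
  assumes H: "pair_graph H" and bip: "bipartition H X Y" and enc: "encodes p H f"
  shows "\<exists>\<B>. r_covers p \<B> (bipartite_complement X Y H)"
proof -
  interpret pair_graph H by (rule H)
  have fin: "finite (X \<union> Y)" and disj: "X \<inter> Y = {}" and V: "pverts H = X \<union> Y"
    using bip pair_finite_verts by (auto simp: bipartition_def)
  have arc: "(u, v) \<in> parcs H \<longleftrightarrow> (\<forall>i<p. f u i \<noteq> f v i)" if "u \<in> X \<union> Y" "v \<in> X \<union> Y" for u v
    using enc that V by (simp add: encodes_def)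
  define L where "L A i c = {v \<in> A. f v i = c}" for A i c
  define B where "B i c = \<lparr>pverts = L X i c \<union> L Y i c,
      parcs = L X i c \<times> L Y i c \<union> L Y i c \<times> L X i c\<rparr>" for i c
  \<comment> \<open>Restricting to values attained by vertices keeps the family finite.\<close>
  define \<B> where "\<B> = (\<lambda>(i, v). B i (f v i)) ` ({..<p} \<times> (X \<union> Y))"
  let ?F = "bipartite_complement X Y H"
  have pv: "pverts ?F = X \<union> Y" and pa: "parcs ?F = (X \<times> Y \<union> Y \<times> X) - parcs H"
    by (simp_all add: bipartite_complement_def)
  have sub: "parcs (B i c) \<subseteq> parcs ?F" if "i < p" for i c
  proof (rule subrelI)
    fix u v assume "(u, v) \<in> parcs (B i c)"
    then have "(u, v) \<in> X \<times> Y \<union> Y \<times> X" "f u i = f v i" by (auto simp: B_def L_def)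
    then show "(u, v) \<in> parcs ?F" using arc[of u v] that by (auto simp: pa)
  qed
  have "r_covers p \<B> ?F"
    unfolding r_covers_def
  proof (intro conjI ballI)
    show "finite \<B>" using fin by (simp add: \<B>_def)
  next
    fix A assume "A \<in> \<B>"
    then obtain i c where i: "i < p" and A: "A = B i c" by (auto simp: \<B>_def)
    have "pverts A \<subseteq> X \<union> Y" "parcs A \<subseteq> pverts A \<times> pverts A"
      by (auto simp: A B_def L_def)
    moreover have "parcs ?F \<subseteq> (X \<union> Y) \<times> (X \<union> Y)" by (auto simp: pa)
    ultimately show "subgraph (with_proj A) (with_proj ?F)"
      using sub[OF i] by (simp add: subgraph_with_proj_iff pv A)
    have "finite (pverts A)" "L X i c \<inter> L Y i c = {}"
      using fin disj by (auto simp: A B_def L_def)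
    then show "biclique A"
      unfolding biclique_iff by (auto simp: A B_def)
  next
    show "(\<Union>A\<in>\<B>. parcs A) = parcs ?F"
    proof (intro equalityI subsetI)
      fix e assume "e \<in> (\<Union>A\<in>\<B>. parcs A)"
      then obtain i c where "i < p" "e \<in> parcs (B i c)" by (auto simp: \<B>_def)
      then show "e \<in> parcs ?F" using sub by blast
    next
      fix e assume e: "e \<in> parcs ?F"
      obtain u v where uv: "e = (u, v)" by fastforce
      then have mem: "u \<in> X \<and> v \<in> Y \<or> u \<in> Y \<and> v \<in> X" and "(u, v) \<notin> parcs H"
        using e by (auto simp: pa)
      then obtain i where i: "i < p" "f u i = f v i" using arc[of u v] by auto
      have "e \<in> parcs (B i (f v i))" using mem i uv by (auto simp: B_def L_def)
      moreover have "B i (f v i) \<in> \<B>" using i mem by (force simp: \<B>_def)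
      ultimately show "e \<in> (\<Union>A\<in>\<B>. parcs A)" by blast
    qed
  next
    fix v
    \<comment> \<open>In coordinate \<open>i\<close>, only the level set of the value
      \<open>f v i\<close> contains \<open>v\<close>.\<close>
    have "{A \<in> \<B>. v \<in> pverts A} \<subseteq> (\<lambda>i. B i (f v i)) ` {..<p}"
    proof
      fix A assume "A \<in> {A \<in> \<B>. v \<in> pverts A}"
      then obtain i u where i: "i < p" and A: "A = B i (f u i)" and "v \<in> pverts A"
        by (auto simp: \<B>_def)
      then have "f v i = f u i" by (auto simp: B_def L_def)
      then show "A \<in> (\<lambda>i. B i (f v i)) ` {..<p}"
        using i A by (intro image_eqI[of _ _ i]) simp_all
    qed
    then show "card {A \<in> \<B>. v \<in> pverts A} \<le> p"
      by (metis card_lessThan finite_lessThan surj_card_le)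
  qed
  then show ?thesis by blast
qed

section \<open>From label sets to codes\<close>

text \<open>Indices from \<open>card S\<close> on are filled with \<open>d\<close>. This default
  comes from outside because \<open>S\<close> may be empty.\<close>

lemma enumerate_padded:
  fixes d :: 'b
  assumes "finite S" and "card S \<le> r"
  obtains c where "S \<subseteq> c ` {..<r}" and "c ` {..<r} \<subseteq> insert d S"
proof -
  obtain xs where xs: "set xs = S" "length xs = card S"
    using finite_distinct_list[OF assms(1)] distinct_card by metis
  define c where "c i = (if i < length xs then xs ! i else d)" for i
  have "S \<subseteq> c ` {..<r}"
  proof
    fix s assume "s \<in> S"
    then obtain i where "i < length xs" "xs ! i = s" using xs(1) by (metis in_set_conv_nth)
    then show "s \<in> c ` {..<r}" using xs(2) assms(2) by (intro image_eqI[of _ _ i]) (auto simp: c_def)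
  qed
  moreover have "c ` {..<r} \<subseteq> insert d S" using xs(1) by (auto simp: c_def)
  ultimately show thesis by (rule that)
qed

text \<open>The labels abstract from the bicliques through a vertex, so that the construction serves
  both for a given cover and for showing that some code exists at all.\<close>

lemma encodes_if_labelling:
  fixes L :: "'a \<Rightarrow> 'l set"
  assumes H: "pair_graph H" and bip: "bipartition H X Y" and "finite U"
    and LU: "\<And>v. v \<in> X \<union> Y \<Longrightarrow> L v \<subseteq> U" and card: "\<And>v. v \<in> X \<union> Y \<Longrightarrow> card (L v) \<le> r"
    and adj: "\<And>x y. x \<in> X \<Longrightarrow> y \<in> Y \<Longrightarrow> (x, y) \<in> parcs H \<longleftrightarrow> L x \<inter> L y = {}"
  shows "\<exists>f. encodes (r\<^sup>2 + 2) H f"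
proof -
  interpret pair_graph H by (rule H)
  have fin: "finite (X \<union> Y)" and disj: "X \<inter> Y = {}" and V: "pverts H = X \<union> Y"
    and E: "parcs H \<subseteq> X \<times> Y \<union> Y \<times> X"
    using bip pair_finite_verts by (auto simp: bipartition_def)
  have sym: "(v, u) \<in> parcs H" if "(u, v) \<in> parcs H" for u v
    using arcs_ends_symmetric[OF sym_arcs] that by simp
  obtain num :: "'a \<Rightarrow> nat" where num: "inj_on num (X \<union> Y)"
    using finite_imp_inj_to_nat_seg[OF fin] by blast
  obtain idx :: "'l \<Rightarrow> nat" where idx: "inj_on idx U"
    using finite_imp_inj_to_nat_seg[OF \<open>finite U\<close>] by blast
  \<comment> \<open>The values \<open>0\<close> and \<open>1\<close> pad the enumerations on \<open>X\<close> and on \<open>Y\<close>; labels start at \<open>2\<close>.\<close>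
  define M where "M v = (\<lambda>l. idx l + 2) ` L v" for v
  define d :: "'a \<Rightarrow> nat" where "d v = (if v \<in> X then 0 else 1)" for v
  have "\<exists>c. M v \<subseteq> c ` {..<r} \<and> c ` {..<r} \<subseteq> insert (d v) (M v)" if v: "v \<in> X \<union> Y" for v
  proof -
    have "finite (L v)" using LU[OF v] \<open>finite U\<close> by (rule finite_subset)
    then have "finite (M v)" "card (M v) \<le> r"
      using card[OF v] card_image_le[of "L v" "\<lambda>l. idx l + 2"] by (auto simp: M_def)
    then show ?thesis by (metis enumerate_padded)
  qed
  then obtain c where c: "\<And>v. v \<in> X \<union> Y \<Longrightarrow> M v \<subseteq> c v ` {..<r}"
      "\<And>v. v \<in> X \<union> Y \<Longrightarrow> c v ` {..<r} \<subseteq> insert (d v) (M v)"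
    by metis
  \<comment> \<open>An index below \<open>r\<^sup>2\<close> stands for the pair of its quotient and
    remainder by \<open>r\<close>; \<open>X\<close> reads the first, \<open>Y\<close> the second.
    Coordinate \<open>r\<^sup>2\<close> is \<open>0\<close> on \<open>X\<close>, coordinate
    \<open>r\<^sup>2 + 1\<close> is \<open>0\<close> on \<open>Y\<close>. Elsewhere these two hold
    \<open>Suc (num v)\<close>, never \<open>0\<close>, so they separate \<open>X\<close> from
    \<open>Y\<close>.\<close>
  define f where "f v i =
     (if i < r\<^sup>2 then c v (if v \<in> X then i div r else i mod r)
      else if (i = r\<^sup>2) = (v \<in> X) then 0 else Suc (num v))" for v i
  have same: "f x i \<noteq> f y i \<longleftrightarrow> c x (i div r) \<noteq> c y (i mod r)"
    if "x \<in> X" "y \<in> Y" "i < r\<^sup>2" for x y i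
    using that disj by (auto simp: f_def)
  have XY: "(x, y) \<in> parcs H \<longleftrightarrow> (\<forall>i<r\<^sup>2+2. f x i \<noteq> f y i)" if x: "x \<in> X" and y: "y \<in> Y" for x y
  proof -
    have "(\<forall>i<r\<^sup>2+2. f x i \<noteq> f y i) \<longleftrightarrow> (\<forall>i<r\<^sup>2. f x i \<noteq> f y i)"
    proof -
      have "f x i \<noteq> f y i" if "\<not> i < r\<^sup>2" for i
        using that x y disj by (auto simp: f_def)
      then show ?thesis by (meson trans_less_add1)
    qed
    also have "\<dots> \<longleftrightarrow> (\<forall>i<r\<^sup>2. c x (i div r) \<noteq> c y (i mod r))"
      using same[OF x y] by blast
    also have "\<dots> \<longleftrightarrow> (\<forall>a<r. \<forall>b<r. c x a \<noteq> c y b)"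
    proof (intro iffI allI impI)
      fix a b assume *: "\<forall>i<r\<^sup>2. c x (i div r) \<noteq> c y (i mod r)" and ab: "a < r" "b < r"
      \<comment> \<open>The pair \<open>(a, b)\<close> is coded by the index
        \<open>a * r + b\<close>.\<close>
      have "a * r + b < Suc a * r" using ab by simp
      also have "\<dots> \<le> r * r" using ab by (intro mult_right_mono) auto
      finally have "a * r + b < r\<^sup>2" by (simp add: power2_eq_square)
      moreover have "(a * r + b) div r = a" "(a * r + b) mod r = b" using ab by auto
      ultimately show "c x a \<noteq> c y b" using * by metis
    next
      fix i assume *: "\<forall>a<r. \<forall>b<r. c x a \<noteq> c y b" and i: "i < r\<^sup>2"
      then have "r > 0" by (cases r) auto
      then have "i div r < r" "i mod r < r"
        using i by (auto simp: power2_eq_square less_mult_imp_div_less)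
      then show "c x (i div r) \<noteq> c y (i mod r)" using * by blast
    qed
    also have "\<dots> \<longleftrightarrow> M x \<inter> M y = {}"
    proof
      assume "\<forall>a<r. \<forall>b<r. c x a \<noteq> c y b"
      then show "M x \<inter> M y = {}" using c(1)[of x] c(1)[of y] x y by blast
    next
      assume MM: "M x \<inter> M y = {}"
      have "d x = 0" "d y = 1" using x y disj by (auto simp: d_def)
      moreover have "\<And>v m. m \<in> M v \<Longrightarrow> m \<ge> 2" by (auto simp: M_def)
      ultimately have "insert (d x) (M x) \<inter> insert (d y) (M y) = {}" using MM by fastforce
      then show "\<forall>a<r. \<forall>b<r. c x a \<noteq> c y b" using c(2)[of x] c(2)[of y] x y by blast
    qed
    also have "\<dots> \<longleftrightarrow> L x \<inter> L y = {}"
    proof -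
      \<comment> \<open>Injectivity on all of \<open>U\<close> lets the image commute with the
        intersection.\<close>
      have "inj_on (\<lambda>l. idx l + 2) U" using idx by (auto simp: inj_on_def)
      then have "M x \<inter> M y = (\<lambda>l. idx l + 2) ` (L x \<inter> L y)"
        unfolding M_def using LU[of x] LU[of y] x y by (metis Un_iff inj_on_image_Int)
      then show ?thesis by simp
    qed
    finally show ?thesis using adj[OF x y] by simp
  qed
  have "encodes (r\<^sup>2 + 2) H f"
    unfolding encodes_def V
  proof (intro conjI ballI impI)
    fix u v assume uv: "u \<in> X \<union> Y" "v \<in> X \<union> Y"
    show "u = v" if "\<forall>i<r\<^sup>2+2. f u i = f v i"
    proof -
      \<comment> \<open>Vertices of different classes would give \<open>0 = Suc _\<close>; within
        one class, one of the two coordinates reveals \<open>num\<close>.\<close>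
      have "f u (r\<^sup>2) = f v (r\<^sup>2)" "f u (r\<^sup>2 + 1) = f v (r\<^sup>2 + 1)" using that by auto
      then have "num u = num v" by (auto simp: f_def split: if_splits)
      then show ?thesis using num uv by (auto dest: inj_onD)
    qed
    consider "u \<in> X" "v \<in> Y" | "u \<in> Y" "v \<in> X" | "u \<in> X" "v \<in> X" | "u \<in> Y" "v \<in> Y"
      using uv by blast
    then show "(u, v) \<in> parcs H \<longleftrightarrow> (\<forall>i<r\<^sup>2+2. f u i \<noteq> f v i)"
    proof cases
      case 1
      then show ?thesis by (rule XY)
    next
      case 2
      have "(u, v) \<in> parcs H \<longleftrightarrow> (v, u) \<in> parcs H" using sym by blast
      then show ?thesis using XY[OF 2(2,1)] by metis
    next
      case 3
      then have "f u (r\<^sup>2) = f v (r\<^sup>2)" by (simp add: f_def)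
      moreover have "(u, v) \<notin> parcs H" using 3 E disj by blast
      ultimately show ?thesis by fastforce
    next
      case 4
      then have "u \<notin> X" "v \<notin> X" using disj by auto
      then have "f u (r\<^sup>2 + 1) = f v (r\<^sup>2 + 1)" by (simp add: f_def)
      moreover have "(u, v) \<notin> parcs H" using 4 E disj by blast
      ultimately show ?thesis by fastforce
    qed
  qed
  then show ?thesis by blast
qed

text \<open>Needed for the least dimension to be attained. Each vertex is labelled by the non-edges
  across the classes incident with it: \<open>x\<close> and \<open>y\<close> share a label exactly
  when \<open>(x, y)\<close> is itself such a non-edge.\<close>

lemma encoding_exists:
  assumes H: "pair_graph H" and bip: "bipartition H X Y"
  shows "\<exists>p f. encodes p H f"
proof -
  have fin: "finite X" "finite Y" and disj: "X \<inter> Y = {}"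
    using bip pair_fin_digraph.pair_finite_verts[of H] H
    by (auto simp: bipartition_def pair_graph_def pair_digraph_def)
  define L where "L v = {e \<in> X \<times> Y - parcs H. v = fst e \<or> v = snd e}" for v
  have LU: "L v \<subseteq> X \<times> Y" for v by (auto simp: L_def)
  have "(x, y) \<in> parcs H \<longleftrightarrow> L x \<inter> L y = {}" if "x \<in> X" "y \<in> Y" for x y
    using that disj by (auto simp: L_def)
  moreover have "finite (X \<times> Y)" using fin by simp
  moreover have "card (L v) \<le> card (X \<times> Y)" for v
    using LU fin by (intro card_mono) auto
  ultimately have "\<exists>f. encodes ((card (X \<times> Y))\<^sup>2 + 2) H f"
    using LU by (intro encodes_if_labelling[OF H bip, where U = "X \<times> Y" and L = L])
  then show ?thesis by blast
qed

section \<open>From a cover to a code\<close>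

text \<open>Edgeless bicliques have to be excluded: they may contain vertices of both classes.\<close>

lemma biclique_subgraph_adjacent:
  assumes "biclique B" and "subgraph (with_proj B) (with_proj F)" and "bipartition F X Y"
    and "parcs B \<noteq> {}" and "x \<in> X" "y \<in> Y" "x \<in> pverts B" "y \<in> pverts B"
  shows "(x, y) \<in> parcs B"
proof -
  obtain U W where UW: "pverts B = U \<union> W" "parcs B = U \<times> W \<union> W \<times> U"
    using assms(1) unfolding biclique_iff by blast
  have sub: "parcs B \<subseteq> X \<times> Y \<union> Y \<times> X" and disj: "X \<inter> Y = {}"
    using assms(2,3) by (auto simp: subgraph_with_proj_iff bipartition_def)
  obtain u w where uw: "u \<in> U" "w \<in> W" using assms(4) UW by auto
  have *: "(a, b) \<in> X \<times> Y \<union> Y \<times> X" if "a \<in> U" "b \<in> W" for a b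
    using sub that UW(2) by blast
  \<comment> \<open>Otherwise \<open>w\<close> would be joined to both \<open>x\<close> and
    \<open>y\<close>, and so lie in both \<open>Y\<close> and \<open>X\<close>. The other side is
    handled symmetrically with \<open>u\<close>.\<close>
  have "\<not> (x \<in> U \<and> y \<in> U)"
    using *[of x w] *[of y w] uw assms(5,6) disj by blast
  moreover have "\<not> (x \<in> W \<and> y \<in> W)"
    using *[of u x] *[of u y] uw assms(5,6) disj by blast
  ultimately show ?thesis using assms(7,8) UW by blast
qed

text \<open>The labels of a vertex are the members of the cover containing it that have an edge.
  Discarding edgeless members loses no covered edge and only lowers the counts.\<close>

lemma encodes_if_covers:
  assumes H: "pair_graph H" and bip: "bipartition H X Y"
    and cov: "r_covers r \<B> (bipartite_complement X Y H)"
  shows "\<exists>f. encodes (r\<^sup>2 + 2) H f"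
proof -
  let ?F = "bipartite_complement X Y H"
  define L where "L v = {B \<in> \<B>. parcs B \<noteq> {} \<and> v \<in> pverts B}" for v
  have F: "pverts ?F = X \<union> Y" "parcs ?F = (X \<times> Y \<union> Y \<times> X) - parcs H"
    and bipF: "bipartition ?F X Y"
    using bip by (auto simp: bipartite_complement_def bipartition_def)
  have un: "(\<Union>B\<in>\<B>. parcs B) = parcs ?F"
    and sub: "\<And>B. B \<in> \<B> \<Longrightarrow> subgraph (with_proj B) (with_proj ?F)"
    and bic: "\<And>B. B \<in> \<B> \<Longrightarrow> biclique B"
    using cov by (auto simp: r_covers_def)
  have fin: "finite \<B>" using cov by (simp add: r_covers_def)
  have LU: "L v \<subseteq> \<B>" for v by (auto simp: L_def)
  have card: "card (L v) \<le> r" if "v \<in> X \<union> Y" for v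
  proof -
    have "card (L v) \<le> card {B \<in> \<B>. v \<in> pverts B}"
      using fin by (intro card_mono) (auto simp: L_def)
    also have "\<dots> \<le> r" using cov that F(1) by (simp add: r_covers_def)
    finally show ?thesis .
  qed
  have adj: "(x, y) \<in> parcs H \<longleftrightarrow> L x \<inter> L y = {}" if x: "x \<in> X" and y: "y \<in> Y" for x y
  proof
    assume xy: "(x, y) \<in> parcs H"
    show "L x \<inter> L y = {}"
    proof (rule ccontr)
      assume "L x \<inter> L y \<noteq> {}"
      then obtain B where "B \<in> \<B>" "parcs B \<noteq> {}" "x \<in> pverts B" "y \<in> pverts B"
        by (auto simp: L_def)
      then have "(x, y) \<in> parcs ?F"
        using biclique_subgraph_adjacent[OF bic sub bipF] x y un by blast
      then show False using xy by (simp add: F)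
    qed
  next
    assume empty: "L x \<inter> L y = {}"
    show "(x, y) \<in> parcs H"
    proof (rule ccontr)
      assume "(x, y) \<notin> parcs H"
      then obtain B where B: "B \<in> \<B>" "(x, y) \<in> parcs B" using un x y F(2) by blast
      moreover have "x \<in> pverts B" "y \<in> pverts B"
        using sub[OF B(1)] B(2) by (auto simp: subgraph_with_proj_iff)
      ultimately show False using empty by (auto simp: L_def)
    qed
  qed
  show ?thesis
    using fin LU card adj
    by (rule encodes_if_labelling[OF H bip, where U = \<B> and L = L])
qed

theorem theorem45:
  fixes H :: "'a pair_pre_digraph" and X Y :: "'a set"
  assumes "pair_graph H"
    and "bipartition H X Y"
  shows "(\<exists>\<B>. r_covers (prague_dim H) \<B> (bipartite_complement X Y H)) \<and>
         (\<forall>r. r_coverable r (bipartite_complement X Y H) \<longrightarrow> prague_dim H \<le> r\<^sup>2 + 2)"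
proof -
  interpret pair_graph H by (rule assms(1))
  have "parcs H \<subseteq> pverts H \<times> pverts H"
    using in_arcsD1 in_arcsD2 by auto
  then have emb: "embeds_in_complete_product H p" if "encodes p H f" for p f
    using embeds_if_encodes pair_finite_verts that by blast
  \<comment> \<open>The least value is attained because some code exists.\<close>
  then have "embeds_in_complete_product H (prague_dim H)"
    unfolding prague_dim_def using encoding_exists[OF assms] LeastI_ex by metis
  then obtain f where "encodes (prague_dim H) H f" using encodes_if_embeds by blast
  then have "\<exists>\<B>. r_covers (prague_dim H) \<B> (bipartite_complement X Y H)"
    by (rule covers_if_encodes[OF assms])
  moreover have "prague_dim H \<le> r\<^sup>2 + 2" if "r_coverable r (bipartite_complement X Y H)" for r
  proof -
    from that obtain \<B> where "r_covers r \<B> (bipartite_complement X Y H)"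
      unfolding r_coverable_def by blast
    then obtain g where "encodes (r\<^sup>2 + 2) H g"
      using encodes_if_covers[OF assms] by blast
    then show ?thesis unfolding prague_dim_def using emb by (intro Least_le)
  qed
  ultimately show ?thesis by blast
qed

end
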